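(* For all $n\ge0$, $H_3^{\lceil n/2\rceil}\subseteq P^n\subseteq H_4^n$, i.e. $P^n$ contains a subgraph isomorphic to $H_3^{\lceil n/2\rceil}$ and $P^n$ is a subgraph of $H_4^n$.
   Context: For $m\ge3$, the Hanoi graph $H_m^n$ has vertex set $\{0,\dots,m-1\}^n$ (words $s_n\cdots s_1$, $s_d$ the peg of disc $d$), two words being adjacent iff they differ in exactly one coordinate $d$, with values $i\ne j$ there, and $s_k\notin\{i,j\}$ for all $k<d$. The parity-constrained Hanoi graph $P^n$: with $p(d)=1$ for even $d$, $p(d)=2$ for odd $d$, and $Q^d=\{0,p(d),3\}$, its vertices are the words $s\in\{0,1,2,3\}^n$ with $s_d\in Q^d$ for all $d$, and two vertices are adjacent iff they differ in exactly one coordinate $d$, with values $i\ne j$ there, $i,j\in Q^d$, and $s_k\notin\{i,j\}$ for all $k<d$. Graphs with $n=0$ have one vertex. *)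

theory Defs
  imports Complex_Main "HOL-Library.FuncSet" "Graph_Theory.Graph_Theory"
begin

text \<open>
  Undirected graphs are symmetric digraphs: an edge between \<open>s\<close> and \<open>t\<close> is
  the pair of arcs \<open>(s, t)\<close> and \<open>(t, s)\<close>. A word \<open>s\<^sub>n \<dots> s\<^sub>1\<close> is an extensional function
  on \<open>{1..n}\<close> with \<open>s d\<close> the peg of disc \<open>d\<close> (the value off \<open>{1..n}\<close> is the fixed
  \<open>undefined\<close>), so for \<open>n = 0\<close> there is exactly one word.
\<close>

definition disc_move :: "nat \<Rightarrow> nat \<Rightarrow> (nat \<Rightarrow> nat) \<Rightarrow> (nat \<Rightarrow> nat) \<Rightarrow> bool" where
  "disc_move n d s t \<longleftrightarrow>
     s d \<noteq> t d \<and> (\<forall>k\<in>{1..n}. k \<noteq> d \<longrightarrow> s k = t k) \<and> (\<forall>k\<in>{1..<d}. s k \<notin> {s d, t d})"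

definition hanoi_verts :: "nat \<Rightarrow> nat \<Rightarrow> (nat \<Rightarrow> nat) set" where
  "hanoi_verts m n = {1..n} \<rightarrow>\<^sub>E {0..<m}"

text \<open>The Hanoi graph \<open>H\<^sub>m\<^sup>n\<close>; it is intended for \<open>m \<ge> 3\<close>.\<close>

definition hanoi_graph :: "nat \<Rightarrow> nat \<Rightarrow> (nat \<Rightarrow> nat) pair_pre_digraph" where
  "hanoi_graph m n =
     \<lparr> pverts = hanoi_verts m n,
       parcs = {(s, t). s \<in> hanoi_verts m n \<and> t \<in> hanoi_verts m n \<and>
                        (\<exists>d\<in>{1..n}. disc_move n d s t)} \<rparr>"

definition parity_peg :: "nat \<Rightarrow> nat" where
  "parity_peg d = (if even d then 1 else 2)"

definition parity_pegs :: "nat \<Rightarrow> nat set" where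
  "parity_pegs d = {0, parity_peg d, 3}"

definition parity_hanoi_verts :: "nat \<Rightarrow> (nat \<Rightarrow> nat) set" where
  "parity_hanoi_verts n =
     {s \<in> {1..n} \<rightarrow>\<^sub>E {0, 1, 2, 3}. \<forall>d\<in>{1..n}. s d \<in> parity_pegs d}"

definition parity_hanoi_graph :: "nat \<Rightarrow> (nat \<Rightarrow> nat) pair_pre_digraph" where
  "parity_hanoi_graph n =
     \<lparr> pverts = parity_hanoi_verts n,
       parcs = {(s, t). s \<in> parity_hanoi_verts n \<and> t \<in> parity_hanoi_verts n \<and>
                        (\<exists>d\<in>{1..n}. disc_move n d s t \<and>
                           s d \<in> parity_pegs d \<and> t d \<in> parity_pegs d)} \<rparr>"

lemma disc_move_sym:
  assumes "d \<le> n" "disc_move n d s t"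
  shows "disc_move n d t s"
  using assms unfolding disc_move_def by fastforce

lemma finite_hanoi_verts: "finite (hanoi_verts m n)"
  by (simp add: hanoi_verts_def finite_PiE)

lemma finite_parity_hanoi_verts: "finite (parity_hanoi_verts n)"
  by (simp add: parity_hanoi_verts_def finite_PiE)

lemma pair_graph_hanoi_graph: "pair_graph (hanoi_graph m n)"
proof
  show "finite (parcs (hanoi_graph m n))"
    by (rule finite_subset[of _ "hanoi_verts m n \<times> hanoi_verts m n"])
      (auto simp: hanoi_graph_def finite_hanoi_verts)
  show "symmetric (with_proj (hanoi_graph m n))"
    by (fastforce simp: symmetric_def hanoi_graph_def sym_def intro: disc_move_sym)
qed (auto simp: hanoi_graph_def finite_hanoi_verts disc_move_def)

lemma pair_graph_parity_hanoi_graph: "pair_graph (parity_hanoi_graph n)"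
proof
  show "finite (parcs (parity_hanoi_graph n))"
    by (rule finite_subset[of _ "parity_hanoi_verts n \<times> parity_hanoi_verts n"])
      (auto simp: parity_hanoi_graph_def finite_parity_hanoi_verts)
  show "symmetric (with_proj (parity_hanoi_graph n))"
    by (fastforce simp: symmetric_def parity_hanoi_graph_def sym_def intro: disc_move_sym)
qed (auto simp: parity_hanoi_graph_def finite_parity_hanoi_verts disc_move_def)

end

theory Submission
  imports Defs
begin

text \<open>
  The even discs of \<open>P\<^sup>n\<close> may be parked on peg 1, which the odd discs never use. The
  \<open>\<lceil>n/2\<rceil>\<close> odd discs then play an unobstructed three-peg game on the pegs 0, 2, 3.
\<close>

text \<open>An arc is the pair of its endpoints, so injectivity of \<open>f\<close> on vertices
  passes to \<open>map_prod f f\<close> on arcs, and \<open>f\<close> is an isomorphism onto its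
  image. That image serves as \<open>K\<close>; since arcs are only required to be preserved, it
  need not be an induced subgraph.\<close>

lemma digraph_iso_subgraph_if_embedding:
  assumes G: "pair_wf_digraph G" and H: "pair_wf_digraph H"
    and inj: "inj_on f (pverts G)"
    and verts: "\<And>u. u \<in> pverts G \<Longrightarrow> f u \<in> pverts H"
    and arcs: "\<And>u v. (u, v) \<in> parcs G \<Longrightarrow> (f u, f v) \<in> parcs H"
  shows "\<exists>K. subgraph K (with_proj H) \<and> digraph_iso (with_proj G) K"
proof -
  let ?hom = "\<lparr>iso_verts = f, iso_arcs = map_prod f f, iso_head = snd, iso_tail = fst\<rparr>"
  interpret G: wf_digraph "with_proj G"
    using G by (simp add: wf_digraph_wp_iff)
  have arcs_sub: "parcs G \<subseteq> pverts G \<times> pverts G"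
    using G.wellformed by auto
  have "inj_on (map_prod f f) (parcs G)"
    using inj_on_subset[OF map_prod_inj_on[OF inj inj] arcs_sub] .
  then have hom: "G.digraph_isomorphism ?hom"
    by (simp add: G.digraph_isomorphism_def G.wf_digraph_axioms inj)
  moreover have "subgraph (app_iso ?hom (with_proj G)) (with_proj H)"
    using G.wf_digraphI_app_iso[OF hom] H verts arcs
    by (intro subgraphI) (auto simp: compatible_def wf_digraph_wp_iff)
  ultimately show ?thesis
    unfolding digraph_iso_def by blast
qed

text \<open>Renames the pegs 0, 1, 2 of the three-peg game to 0, 2, 3, the pegs allowed to odd
  discs. Being total and injective on all naturals, it can be cancelled without bounds on the
  pegs.\<close>

definition skip_one :: "nat \<Rightarrow> nat" where
  "skip_one i = (if i = 0 then 0 else Suc i)"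

lemma skip_one_eq_iff [simp]: "skip_one i = skip_one j \<longleftrightarrow> i = j"
  by (simp add: skip_one_def)

lemma skip_one_neq_one [simp]: "skip_one i \<noteq> Suc 0" "Suc 0 \<noteq> skip_one i"
  by (auto simp: skip_one_def)

text \<open>Disc \<open>d\<close> of the small game is played by disc \<open>2 * d - 1\<close>;
  conversely an odd disc \<open>k\<close> plays disc \<open>Suc k div 2\<close>. Restricting to
  \<open>{1..n}\<close> keeps the word extensional.\<close>

definition odd_embedding :: "nat \<Rightarrow> (nat \<Rightarrow> nat) \<Rightarrow> nat \<Rightarrow> nat" where
  "odd_embedding n s = (\<lambda>d\<in>{1..n}. if even d then 1 else skip_one (s (Suc d div 2)))"

lemma odd_embedding_odd_disc:
  assumes "d \<in> {1..Suc n div 2}"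
  shows "2 * d - 1 \<in> {1..n}" "odd_embedding n s (2 * d - 1) = skip_one (s d)"
proof -
  show "2 * d - 1 \<in> {1..n}"
    using assms by auto
  moreover have "odd (2 * d - 1)" "Suc (2 * d - 1) div 2 = d"
    using assms by auto
  ultimately show "odd_embedding n s (2 * d - 1) = skip_one (s d)"
    by (simp add: odd_embedding_def)
qed

lemma odd_embedding_in_verts:
  assumes "s \<in> hanoi_verts 3 (Suc n div 2)"
  shows "odd_embedding n s \<in> parity_hanoi_verts n"
proof -
  have "skip_one (s (Suc d div 2)) \<in> {0, 2, 3}" if "d \<in> {1..n}" for d
  proof -
    have "Suc d div 2 \<in> {1..Suc n div 2}"
      using that by (auto intro: div_le_mono)
    then have "s (Suc d div 2) < 3"
      using assms by (auto simp: hanoi_verts_def PiE_iff)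
    then show ?thesis
      by (auto simp: skip_one_def)
  qed
  then show ?thesis
    by (auto simp: parity_hanoi_verts_def odd_embedding_def parity_pegs_def parity_peg_def
        simp del: odd_Suc_div_two)
qed

text \<open>Each letter of the small word can be read back from an odd disc, and an extensional word
  is determined by its letters.\<close>

lemma inj_on_odd_embedding: "inj_on (odd_embedding n) (hanoi_verts m (Suc n div 2))"
proof (rule inj_onI)
  fix s t
  assume st: "s \<in> hanoi_verts m (Suc n div 2)" "t \<in> hanoi_verts m (Suc n div 2)"
    and eq: "odd_embedding n s = odd_embedding n t"
  have "s d = t d" if "d \<in> {1..Suc n div 2}" for d
    using odd_embedding_odd_disc(2)[OF that, of s] odd_embedding_odd_disc(2)[OF that, of t] eq
    by simp
  with st show "s = t"
    unfolding hanoi_verts_def by (meson PiE_ext)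
qed

lemma disc_move_odd_embedding:
  assumes d: "d \<in> {1..Suc n div 2}" and move: "disc_move (Suc n div 2) d s t"
  shows "disc_move n (2 * d - 1) (odd_embedding n s) (odd_embedding n t)"
  unfolding disc_move_def odd_embedding_odd_disc(2)[OF d]
proof (intro conjI ballI impI)
  show "skip_one (s d) \<noteq> skip_one (t d)"
    using move by (simp add: disc_move_def)
next
  fix k assume k: "k \<in> {1..n}" "k \<noteq> 2 * d - 1"
  \<comment> \<open>Even discs stay on peg 1 in both words, so only odd ones need comparing. For odd
    \<open>k\<close>, \<open>k \<noteq> 2 * d - 1\<close> means that the disc played by
    \<open>k\<close> is not \<open>d\<close>.\<close>
  have "s (Suc k div 2) = t (Suc k div 2)" if "odd k"
  proof -
    have "Suc k div 2 \<in> {1..Suc n div 2}" "Suc k div 2 \<noteq> d"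
      using k that by (auto intro: div_le_mono elim!: oddE)
    then show ?thesis
      using move by (auto simp: disc_move_def)
  qed
  then show "odd_embedding n s k = odd_embedding n t k"
    by (simp add: odd_embedding_def)
next
  fix k assume k: "k \<in> {1..<2 * d - 1}"
  have "k \<in> {1..n}"
    using k odd_embedding_odd_disc(1)[OF d] by auto
  \<comment> \<open>A smaller odd disc plays a disc below \<open>d\<close>, which the move in the
    small game keeps off both pegs. A smaller even disc sits on peg 1, outside the range of
    \<open>skip_one\<close>, so it never blocks.\<close>
  moreover have "s (Suc k div 2) \<notin> {s d, t d}" if "odd k"
  proof -
    have "Suc k div 2 \<in> {1..<d}"
      using k that by (auto elim!: oddE)
    then show ?thesis
      using move by (auto simp: disc_move_def)
  qed
  ultimately show "odd_embedding n s k \<notin> {skip_one (s d), skip_one (t d)}"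
    by (auto simp: odd_embedding_def)
qed

lemma odd_embedding_in_arcs:
  assumes "(s, t) \<in> parcs (hanoi_graph 3 (Suc n div 2))"
  shows "(odd_embedding n s, odd_embedding n t) \<in> parcs (parity_hanoi_graph n)"
proof -
  obtain d where d: "d \<in> {1..Suc n div 2}" "disc_move (Suc n div 2) d s t"
    and st: "s \<in> hanoi_verts 3 (Suc n div 2)" "t \<in> hanoi_verts 3 (Suc n div 2)"
    using assms by (auto simp: hanoi_graph_def)
  \<comment> \<open>Arcs of the parity graph also ask for allowed pegs at the moved disc; both
    endpoints being vertices supplies this.\<close>
  have "odd_embedding n u (2 * d - 1) \<in> parity_pegs (2 * d - 1)"
    if "odd_embedding n u \<in> parity_hanoi_verts n" for u
    using that odd_embedding_odd_disc(1)[OF d(1)] by (auto simp: parity_hanoi_verts_def)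
  with disc_move_odd_embedding[OF d] odd_embedding_odd_disc(1)[OF d(1)] st[THEN odd_embedding_in_verts]
  show ?thesis
    unfolding parity_hanoi_graph_def by auto
qed

lemma parity_hanoi_verts_subset: "parity_hanoi_verts n \<subseteq> hanoi_verts 4 n"
proof -
  have "{0, 1, 2, 3} = {0..<4::nat}"
    by auto
  then show ?thesis
    by (auto simp: parity_hanoi_verts_def hanoi_verts_def)
qed

lemma nat_ceiling_half: "nat \<lceil>real n / 2\<rceil> = Suc n div 2"
  by (cases "even n") (auto elim!: evenE oddE simp: ceiling_eq_iff nat_eq_iff)

theorem theorem6p12:
  fixes n :: nat
  shows "(\<exists>K. subgraph K (with_proj (parity_hanoi_graph n)) \<and>
              digraph_iso (with_proj (hanoi_graph 3 (nat \<lceil>real n / 2\<rceil>))) K) \<and>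
         subgraph (with_proj (parity_hanoi_graph n)) (with_proj (hanoi_graph 4 n))"
proof
  have wf: "pair_wf_digraph (parity_hanoi_graph n)" "pair_wf_digraph (hanoi_graph m k)" for m k
    by (simp_all add: pair_graph_parity_hanoi_graph pair_graph_hanoi_graph pair_graph.axioms(1)
        pair_digraph.axioms(1) pair_fin_digraph.axioms(1))
  show "\<exists>K. subgraph K (with_proj (parity_hanoi_graph n)) \<and>
            digraph_iso (with_proj (hanoi_graph 3 (nat \<lceil>real n / 2\<rceil>))) K"
    unfolding nat_ceiling_half
  proof (rule digraph_iso_subgraph_if_embedding[OF wf(2) wf(1)])
    show "inj_on (odd_embedding n) (pverts (hanoi_graph 3 (Suc n div 2)))"
      by (simp add: hanoi_graph_def inj_on_odd_embedding)
  next
    fix s assume "s \<in> pverts (hanoi_graph 3 (Suc n div 2))"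
    then show "odd_embedding n s \<in> pverts (parity_hanoi_graph n)"
      by (simp add: hanoi_graph_def parity_hanoi_graph_def odd_embedding_in_verts)
  qed (rule odd_embedding_in_arcs)
  show "subgraph (with_proj (parity_hanoi_graph n)) (with_proj (hanoi_graph 4 n))"
  proof (rule subgraphI)
    show "verts (with_proj (parity_hanoi_graph n)) \<subseteq> verts (with_proj (hanoi_graph 4 n))"
      using parity_hanoi_verts_subset by (simp add: parity_hanoi_graph_def hanoi_graph_def)
    \<comment> \<open>Both graphs use the same relation \<open>disc_move\<close>, so an arc of the
      parity graph is a legal four-peg move between the same words.\<close>
    show "arcs (with_proj (parity_hanoi_graph n)) \<subseteq> arcs (with_proj (hanoi_graph 4 n))"
      using parity_hanoi_verts_subset by (auto simp: parity_hanoi_graph_def hanoi_graph_def)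
  qed (simp_all add: wf wf_digraph_wp_iff compatible_def)
qed

end
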